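(* Let $p\in[1,+\infty[$, $n\ge 2$, let $(I_k)_{0\le k\le n}$ be intervals of $\mathbb{R}$ with $I_n=I$, and let $g_k: I_k\to I_{k-1}$ ($1\le k\le n$) be differentiable functions. For $0\le k\le n-1$ put $J_k=(g_{k+1}\circ g_{k+2}\circ\cdots\circ g_n)(I)$, and $J_n=I$; suppose $g_k'\in\mathcal{V}_p(J_k)$ for $1\le k\le n$. Let $h\in\mathcal{V}_p(I)$, $t_0\in I$ and $\alpha\in\mathbb{R}$ be such that $$(g_1\circ g_2\circ\cdots\circ g_n)(t)=\alpha+\int_{t_0}^t h(x)\,dx\qquad\text{for all } t\in I,$$ and let $f\in\mathcal{V}_p(J_0)$, where $J_0=(g_1\circ\cdots\circ g_n)(I)$. Then: (i) $$\left\|(g_1\circ\cdots\circ g_n)'\right\|_{\mathcal{V}_p(I)}=\left\|g_n'\times\prod_{i=1}^{n-1}\left[g_i'\circ(g_{i+1}\circ\cdots\circ g_n)\right]\right\|_{\mathcal{V}_p(I)}\le 2^{\frac{n-1}{p}}\,\|g_n'\|_{\mathcal{V}_p(I)}\times\prod_{k=1}^{n-1}\|g_k'\|_{\mathcal{V}_p(J_k)}.$$ (ii) $$\left\|\left[f\circ(g_1\circ\cdots\circ g_n)\right]\times h\right\|_{\mathcal{V}_p(I)}\le 2^{\frac{n}{p}}\,\|f\|_{\mathcal{V}_p(J_0)}\times\|g_n'\|_{\mathcal{V}_p(I)}\times\prod_{k=1}^{n-1}\|g_k'\|_{\mathcal{V}_p(J_k)}.$$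
   Context: For an interval $J$ of $\mathbb{R}$ and $p\in[1,+\infty[$, $\mathcal{V}_p(J)$ is the set of functions $u:J\to\mathbb{R}$ of bounded $p$-variation, i.e. for which there is $c>0$ with $\sum_{k=1}^N|u(t_k)-u(t_{k-1})|^p\le c^p$ for all finite sequences $t_0<t_1<\dots<t_N$ in $J$. The infimum of such constants $c$ is denoted $\nu_p(u,J)$, and the norm is $$\|u\|_{\mathcal{V}_p(J)}=\sup_{x\in J}|u(x)|+\nu_p(u,J).$$ When a function (such as $g_k'$, defined on $I_k$) is considered in $\mathcal{V}_p(J)$ with $J\subset I_k$, its restriction to $J$ is meant. Products of functions are pointwise.
   Formalization: Part (ii) is proved under the extra condition that h equals its limit along I wherever that limit exists (so h is the derivative of the composition); as stated it fails, e.g. g_2 = 0, f = 1, h the indicator of a point. The intervals I_k, k ≥ 1, are taken nondegenerate. *)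

theory Defs
  imports "HOL-Analysis.Analysis"
begin

text \<open>Functions on a set \<open>J\<close> are total functions of type \<open>real \<Rightarrow> real\<close>; every notion below depends
  only on the values on \<open>J\<close>, so restricting to a smaller set just means changing \<open>J\<close>.\<close>

definition pvar_bound :: "real \<Rightarrow> real set \<Rightarrow> (real \<Rightarrow> real) \<Rightarrow> real \<Rightarrow> bool" where
  "pvar_bound p J u c \<longleftrightarrow> c > 0 \<and>
     (\<forall>(N::nat) (t::nat \<Rightarrow> real). t ` {..N} \<subseteq> J \<longrightarrow> strict_mono_on {..N} t \<longrightarrow>
        (\<Sum>k = 1..N. \<bar>u (t k) - u (t (k - 1))\<bar> powr p) \<le> c powr p)"

definition Vp :: "real \<Rightarrow> real set \<Rightarrow> (real \<Rightarrow> real) set" where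
  "Vp p J = {u. \<exists>c. pvar_bound p J u c}"

definition nu_p :: "real \<Rightarrow> real set \<Rightarrow> (real \<Rightarrow> real) \<Rightarrow> real" where
  "nu_p p J u = Inf {c. pvar_bound p J u c}"

text \<open>This is a genuine norm value only for \<open>u \<in> Vp p J\<close> and \<open>J \<noteq> {}\<close>; otherwise the real-valued
  supremum or infimum may be unspecified.\<close>

definition Vp_norm :: "real \<Rightarrow> real set \<Rightarrow> (real \<Rightarrow> real) \<Rightarrow> real" where
  "Vp_norm p J u = (SUP x\<in>J. \<bar>u x\<bar>) + nu_p p J u"

text \<open>\<open>comp_chain g i n = g i \<circ> g (i + 1) \<circ> \<dots> \<circ> g n\<close>, which is the identity if \<open>i > n\<close>.\<close>

definition comp_chain :: "(nat \<Rightarrow> real \<Rightarrow> real) \<Rightarrow> nat \<Rightarrow> nat \<Rightarrow> real \<Rightarrow> real" where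
  "comp_chain g i n = foldr (\<circ>) (map g [i..<Suc n]) id"

text \<open>The derivative of \<open>u\<close> as a function on \<open>S\<close>, one-sided at endpoints belonging to \<open>S\<close>. It is
  well defined only if \<open>S\<close> has no isolated points.\<close>

abbreviation deriv_within :: "real set \<Rightarrow> (real \<Rightarrow> real) \<Rightarrow> real \<Rightarrow> real" where
  "deriv_within S u \<equiv> (\<lambda>x. vector_derivative u (at x within S))"

text \<open>An indefinite integral does not change if \<open>h\<close> is altered at isolated points, whereas
  \<open>Vp_norm p J h\<close> does. The following normalization excludes such alterations: wherever \<open>h\<close> has a
  limit, its value is that limit.\<close>

definition no_removable_discontinuity_on :: "real set \<Rightarrow> (real \<Rightarrow> real) \<Rightarrow> bool" where
  "no_removable_discontinuity_on S h \<longleftrightarrow>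
     (\<forall>x\<in>S. \<forall>l. (h \<longlongrightarrow> l) (at x within S) \<longrightarrow> h x = l)"

end

theory Submission
  imports Defs
begin

text \<open>
  Everything rests on one estimate for a single inner function: if \<open>g\<close> is differentiable on an
  interval \<open>J\<close> with derivative \<open>d \<in> Vp p J\<close>, and \<open>f\<close> has bounded \<open>p\<close>-variation on \<open>g ` J\<close>, then
  \<open>(f \<circ> g) * d\<close> has bounded \<open>p\<close>-variation and its norm is at most \<open>2 powr (1 / p)\<close> times the product
  of the norms of \<open>f\<close> and \<open>d\<close> (\<open>Vp_norm_comp_times_deriv_le\<close>). The composition \<open>f \<circ> g\<close> alone may
  well have infinite \<open>p\<close>-variation, because \<open>g\<close> may oscillate; but \<open>g\<close> can only turn back at a zero
  of \<open>d\<close>, and there the factor \<open>d\<close> is small.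

  In detail, along a partition \<open>t\<close> every increment of \<open>(f \<circ> g) * d\<close> is at most
  \<open>sup \<bar>f\<bar> * \<bar>\<Delta> d\<bar> + min \<bar>d (t k)\<bar> \<bar>d (t (k - 1))\<bar> * \<bar>\<Delta> (f \<circ> g)\<bar>\<close>, and by Minkowski's inequality
  the two terms can be estimated separately. The first one is controlled by the variation of \<open>d\<close>. For
  the second one, cut the partition at zeros of \<open>d\<close>. On a run without zeros, \<open>g\<close> is strictly
  monotone, so the \<open>p\<close>-th powers of the increments of \<open>f \<circ> g\<close> add up to at most the \<open>p\<close>-variation
  of \<open>f\<close>, while the \<open>p\<close>-th power of \<open>\<bar>d\<bar>\<close> is at most the variation that \<open>d\<close> accumulates between the
  run and an adjacent zero (if \<open>d\<close> has no zeros, there is only one run, on which \<open>\<bar>d\<bar>\<close> is at most its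
  supremum). Summation over the runs gives one copy of the variation of \<open>d\<close>, and the
  steps across zeros give a second one; this is where the factor \<open>2\<close> comes from
  (\<open>sum_weighted_increments_le\<close>).

  By the chain rule the derivative of the composition is the product in (i), and peeling off the
  innermost function repeatedly yields (i) from the estimate, starting with the derivative of \<open>g 1\<close>,
  and a bound for \<open>f \<circ> G\<close> times the derivative of \<open>G = g 1 \<circ> \<dots> \<circ> g n\<close>, starting with \<open>f\<close>
  (\<open>Vp_norm_comp_chain_times_prod_le\<close>). Finally \<open>h\<close> is the derivative of \<open>G\<close>: as \<open>h\<close>
  oscillates arbitrarily little on short one-sided neighbourhoods of a point, the difference quotients
  of its indefinite integral force it to converge to the derivative of \<open>G\<close> there
  (\<open>Vp_integrand_tendsto_derivative\<close>), and without removable discontinuities it takes this value.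
\<close>

section \<open>Functions of bounded p-variation\<close>

lemma powr_convex_nonneg:
  fixes p a b x y :: real
  assumes "p \<ge> 1" "a \<ge> 0" "b \<ge> 0" "a + b = 1" "x \<ge> 0" "y \<ge> 0"
  shows "(a * x + b * y) powr p \<le> a * x powr p + b * y powr p"
proof -
  have scale: "(c * z) powr p \<le> c * z powr p" if "0 \<le> c" "c \<le> 1" "0 \<le> z" for c z :: real
  proof (cases "c = 0")
    case False
    then have "c powr p \<le> c powr 1"
      using that assms(1) by (intro powr_mono') auto
    then show ?thesis
      using that by (auto simp: powr_mult intro: mult_right_mono)
  qed simp
  show ?thesis
  proof (cases "x > 0 \<and> y > 0")
    case True
    then show ?thesis
      using convex_onD[OF powr_convex[OF assms(1)], of b x y] assms
      by (simp add: eq_diff_eq[symmetric])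
  next
    case False
    then have "x = 0 \<or> y = 0" using assms by auto
    then show ?thesis using scale[of a x] scale[of b y] assms by auto
  qed
qed

text \<open>Minkowski's inequality, with upper bounds \<open>X\<close> and \<open>Y\<close> in place of the two \<open>p\<close>-norms.\<close>
lemma minkowski_sum_le:
  fixes x y :: "'a \<Rightarrow> real"
  assumes "p \<ge> 1" "finite S" "\<And>k. k \<in> S \<Longrightarrow> x k \<ge> 0" "\<And>k. k \<in> S \<Longrightarrow> y k \<ge> 0"
    and "X \<ge> 0" "Y > 0"
    and X: "(\<Sum>k\<in>S. x k powr p) \<le> X powr p" and Y: "(\<Sum>k\<in>S. y k powr p) \<le> Y powr p"
  shows "(\<Sum>k\<in>S. (x k + y k) powr p) \<le> (X + Y) powr p"
proof (cases "X = 0")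
  case True
  then have "(\<Sum>k\<in>S. x k powr p) = 0"
    using X by (simp add: sum_nonneg order_antisym)
  then have "\<And>k. k \<in> S \<Longrightarrow> x k = 0"
    using assms(2) by (simp add: sum_nonneg_eq_0_iff)
  then show ?thesis using True Y by simp
next
  case False
  then have "X > 0" using assms by simp
  \<comment> \<open>\<open>x + y\<close> is \<open>X + Y\<close> times a convex combination of \<open>x / X\<close> and \<open>y / Y\<close>.\<close>
  define a where "a = X / (X + Y)"
  define b where "b = Y / (X + Y)"
  have ab: "a \<ge> 0" "b \<ge> 0" "a + b = 1"
    using \<open>X > 0\<close> \<open>Y > 0\<close> by (auto simp: a_def b_def add_divide_distrib[symmetric])
  have pw: "(x k + y k) powr p \<le> (X + Y) powr p * (a * (x k powr p / X powr p) + b * (y k powr p / Y powr p))"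
    if "k \<in> S" for k
  proof -
    have "(X + Y) * a = X" "(X + Y) * b = Y"
      using \<open>X > 0\<close> \<open>Y > 0\<close> by (auto simp: a_def b_def)
    then have "x k + y k = (X + Y) * (a * (x k / X) + b * (y k / Y))"
      using \<open>X > 0\<close> \<open>Y > 0\<close> by (simp add: distrib_left flip: mult.assoc)
    moreover have "(a * (x k / X) + b * (y k / Y)) \<ge> 0"
      using ab \<open>X > 0\<close> \<open>Y > 0\<close> assms(3,4)[OF that] by simp
    ultimately have "(x k + y k) powr p = (X + Y) powr p * (a * (x k / X) + b * (y k / Y)) powr p"
      using \<open>X > 0\<close> \<open>Y > 0\<close> by (simp add: powr_mult)
    also have "\<dots> \<le> (X + Y) powr p * (a * (x k / X) powr p + b * (y k / Y) powr p)"
      using ab assms(3,4)[OF that] \<open>X > 0\<close> \<open>Y > 0\<close>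
      by (intro mult_left_mono powr_convex_nonneg assms) auto
    also have "\<dots> = (X + Y) powr p * (a * (x k powr p / X powr p) + b * (y k powr p / Y powr p))"
      using \<open>X > 0\<close> \<open>Y > 0\<close> assms(3,4)[OF that] by (simp add: powr_divide)
    finally show ?thesis .
  qed
  have "(\<Sum>k\<in>S. (x k + y k) powr p)
      \<le> (\<Sum>k\<in>S. (X + Y) powr p * (a * (x k powr p / X powr p) + b * (y k powr p / Y powr p)))"
    by (rule sum_mono) (rule pw)
  also have "\<dots> = (X + Y) powr p * (a * ((\<Sum>k\<in>S. x k powr p) / X powr p)
      + b * ((\<Sum>k\<in>S. y k powr p) / Y powr p))"
    by (simp add: sum_distrib_left sum.distrib sum_divide_distrib distrib_left)
  also have "\<dots> \<le> (X + Y) powr p * (a * 1 + b * 1)"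
    using X Y ab \<open>X > 0\<close> \<open>Y > 0\<close>
    by (intro mult_left_mono add_mono) (auto simp: divide_le_eq)
  finally show ?thesis using ab by simp
qed

lemma pvar_boundD:
  fixes t :: "nat \<Rightarrow> real"
  assumes "pvar_bound p J u c" "t ` {..N} \<subseteq> J" "strict_mono_on {..N} t"
  shows "(\<Sum>k = 1..N. \<bar>u (t k) - u (t (k - 1))\<bar> powr p) \<le> c powr p"
  using assms unfolding pvar_bound_def by blast

lemma pvar_bound_pos: "pvar_bound p J u c \<Longrightarrow> c > 0"
  by (simp add: pvar_bound_def)

lemma pvar_bound_increment:
  assumes "pvar_bound p J u c" "p \<ge> 1" "x \<in> J" "y \<in> J"
  shows "\<bar>u x - u y\<bar> \<le> c"
proof -
  have *: "\<bar>u b - u a\<bar> \<le> c" if "a \<in> J" "b \<in> J" "a < b" for a b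
  proof -
    define \<tau> where "\<tau> k = (if k = 0 then a else b)" for k :: nat
    have "strict_mono_on {..1} \<tau>"
      using that by (auto simp: strict_mono_on_def \<tau>_def)
    moreover have "\<tau> ` {..1} \<subseteq> J" using that by (auto simp: \<tau>_def)
    ultimately have "(\<Sum>k = 1..1. \<bar>u (\<tau> k) - u (\<tau> (k - 1))\<bar> powr p) \<le> c powr p"
      using pvar_boundD[OF assms(1)] by blast
    then have "\<bar>u b - u a\<bar> powr p \<le> c powr p" by (simp add: \<tau>_def)
    then show ?thesis
      using powr_less_mono2[of p c "\<bar>u b - u a\<bar>"] assms(2) pvar_bound_pos[OF assms(1)]
      by linarith
  qed
  show ?thesis
    using *[of x y] *[of y x] assms pvar_bound_pos[OF assms(1)]
    by (cases x y rule: linorder_cases) auto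
qed

text \<open>The \<open>p\<close>-variation of \<open>u\<close> is dominated by the increments of a bounded monotone function:
  \<open>v t\<close> is the supremum of the \<open>p\<close>-variation sums over all partitions in \<open>J\<close> whose last point is \<open>t\<close>.\<close>
lemma pvar_control:
  assumes "pvar_bound p J u c"
  shows "\<exists>v. (\<forall>s\<in>J. \<forall>t\<in>J. s \<le> t \<longrightarrow> \<bar>u t - u s\<bar> powr p \<le> v t - v s) \<and>
    (\<forall>t\<in>J. 0 \<le> v t \<and> v t \<le> c powr p)"
proof -
  define P where "P N \<tau> = (\<Sum>k = 1..N. \<bar>u (\<tau> k) - u (\<tau> (k - 1))\<bar> powr p)" for N and \<tau> :: "nat \<Rightarrow> real"
  define A where "A t = {P N \<tau> | N \<tau>. \<tau> ` {..N} \<subseteq> J \<and> strict_mono_on {..N} \<tau> \<and> \<tau> N = t}" for t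
  define v where "v t = Sup (A t)" for t
  have A_le: "a \<le> c powr p" if "a \<in> A t" for a t
    using that pvar_boundD[OF assms] unfolding A_def P_def by blast
  then have bdd: "bdd_above (A t)" for t by (meson bdd_above.I)
  have zero: "0 \<in> A t" if "t \<in> J" for t
  proof -
    have "P 0 (\<lambda>_. t) \<in> A t"
      unfolding A_def using that by (auto simp: strict_mono_on_def intro!: exI[of _ "0::nat"] exI[of _ "\<lambda>_. t"])
    then show ?thesis by (simp add: P_def)
  qed
  \<comment> \<open>A partition ending at \<open>s\<close> can be prolonged by the point \<open>t\<close>.\<close>
  have ext: "a + \<bar>u t - u s\<bar> powr p \<in> A t" if "a \<in> A s" "t \<in> J" "s < t" for a s t
  proof -
    obtain N \<tau> where \<tau>: "a = P N \<tau>" "\<tau> ` {..N} \<subseteq> J" "strict_mono_on {..N} \<tau>" "\<tau> N = s"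
      using \<open>a \<in> A s\<close> unfolding A_def by blast
    define \<sigma> where "\<sigma> = \<tau>(Suc N := t)"
    have "P (Suc N) \<sigma> = P N \<sigma> + \<bar>u t - u s\<bar> powr p"
      by (simp add: P_def \<sigma>_def \<tau>(4))
    also have "P N \<sigma> = P N \<tau>"
      unfolding P_def \<sigma>_def by (rule sum.cong) auto
    finally have "P (Suc N) \<sigma> = a + \<bar>u t - u s\<bar> powr p" by (simp add: \<tau>)
    moreover have "\<sigma> ` {..Suc N} \<subseteq> J" using \<tau>(2) that(2) by (auto simp: \<sigma>_def le_Suc_eq)
    moreover have "strict_mono_on {..Suc N} \<sigma>"
    proof (rule strict_mono_onI)
      fix i j assume ij: "i \<in> {..Suc N}" "j \<in> {..Suc N}" "i < j"
      then have "\<tau> i \<le> s" using strict_mono_on_leD[OF \<tau>(3), of i N] \<tau>(4) by simp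
      then show "\<sigma> i < \<sigma> j"
        using ij \<tau>(3) that(3) by (auto simp: \<sigma>_def le_Suc_eq strict_mono_on_def)
    qed
    moreover have "\<sigma> (Suc N) = t" by (simp add: \<sigma>_def)
    ultimately show ?thesis
      unfolding A_def by (intro CollectI exI[of _ "Suc N"] exI[of _ \<sigma>]) simp
  qed
  show ?thesis
  proof (intro exI[of _ v] conjI ballI impI)
    fix s t assume st: "s \<in> J" "t \<in> J" "s \<le> t"
    show "\<bar>u t - u s\<bar> powr p \<le> v t - v s"
    proof (cases "s = t")
      case False
      have "v s \<le> v t - \<bar>u t - u s\<bar> powr p"
        unfolding v_def
      proof (rule cSup_least)
        show "A s \<noteq> {}" using zero st by blast
        fix a assume "a \<in> A s"
        then have "a + \<bar>u t - u s\<bar> powr p \<in> A t" using ext st False by simp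
        then have "a + \<bar>u t - u s\<bar> powr p \<le> Sup (A t)" by (rule cSup_upper[OF _ bdd])
        then show "a \<le> Sup (A t) - \<bar>u t - u s\<bar> powr p" by simp
      qed
      then show ?thesis by simp
    qed simp
  next
    fix t assume "t \<in> J"
    then show "0 \<le> v t" unfolding v_def using zero bdd by (simp add: cSup_upper)
    show "v t \<le> c powr p" unfolding v_def using zero[OF \<open>t \<in> J\<close>] A_le
      by (intro cSup_least) auto
  qed
qed

lemma pvar_bound_sum_mono:
  fixes s :: "nat \<Rightarrow> real"
  assumes f: "pvar_bound p K f c" and "s ` {m..n} \<subseteq> K"
    and mono: "strict_mono_on {m..n} s \<or> strict_antimono_on {m..n} s"
  shows "(\<Sum>k\<in>{m<..n}. \<bar>f (s k) - f (s (k - 1))\<bar> powr p) \<le> c powr p"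
proof (cases "m \<le> n")
  case True
  define N where "N = n - m"
  from mono show ?thesis
  proof
    assume mono: "strict_mono_on {m..n} s"
    have "strict_mono_on {..N} (\<lambda>k. s (m + k))"
      using mono True unfolding monotone_on_def N_def by simp
    moreover have "(\<lambda>k. s (m + k)) ` {..N} \<subseteq> K"
      using assms(2) True by (auto simp: N_def image_subset_iff)
    ultimately have "(\<Sum>k = 1..N. \<bar>f (s (m + k)) - f (s (m + (k - 1)))\<bar> powr p) \<le> c powr p"
      by (rule pvar_boundD[OF f, rotated])
    also have "(\<Sum>k = 1..N. \<bar>f (s (m + k)) - f (s (m + (k - 1)))\<bar> powr p)
        = (\<Sum>k\<in>{m<..n}. \<bar>f (s k) - f (s (k - 1))\<bar> powr p)"
      by (rule sum.reindex_bij_witness[of _ "\<lambda>k. k - m" "\<lambda>k. m + k"]) (auto simp: N_def)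
    finally show ?thesis .
  next
    assume mono: "strict_antimono_on {m..n} s"
    have "strict_mono_on {..N} (\<lambda>k. s (n - k))"
      using mono True unfolding monotone_on_def N_def by simp
    moreover have "(\<lambda>k. s (n - k)) ` {..N} \<subseteq> K"
      using assms(2) True by (auto simp: N_def image_subset_iff)
    ultimately have "(\<Sum>k = 1..N. \<bar>f (s (n - k)) - f (s (n - (k - 1)))\<bar> powr p) \<le> c powr p"
      by (rule pvar_boundD[OF f, rotated])
    also have "(\<Sum>k = 1..N. \<bar>f (s (n - k)) - f (s (n - (k - 1)))\<bar> powr p)
        = (\<Sum>k\<in>{m<..n}. \<bar>f (s k) - f (s (k - 1))\<bar> powr p)"
      by (rule sum.reindex_bij_witness[of _ "\<lambda>k. n + 1 - k" "\<lambda>k. n + 1 - k"])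
        (auto simp: N_def abs_minus_commute Suc_diff_le)
    finally show ?thesis .
  qed
qed simp

lemma pvar_bound_subset: "pvar_bound p J u c \<Longrightarrow> K \<subseteq> J \<Longrightarrow> pvar_bound p K u c"
  unfolding pvar_bound_def using subset_trans by blast

lemma Vp_bdd_above:
  assumes "u \<in> Vp p J" "p \<ge> 1"
  shows "bdd_above ((\<lambda>x. \<bar>u x\<bar>) ` J)"
proof (cases "J = {}")
  case False
  then obtain a where "a \<in> J" by blast
  from assms(1) obtain c where c: "pvar_bound p J u c" unfolding Vp_def by blast
  have "\<bar>u x\<bar> \<le> \<bar>u a\<bar> + c" if "x \<in> J" for x
    using pvar_bound_increment[OF c assms(2) that \<open>a \<in> J\<close>] by linarith
  then show ?thesis by (rule bdd_aboveI2)
qed simp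

lemma le_affine_cInf:
  fixes S :: "real set"
  assumes "S \<noteq> {}" "b \<ge> 0" "\<And>c. c \<in> S \<Longrightarrow> K \<le> a + b * c"
  shows "K \<le> a + b * Inf S"
proof (cases "b = 0")
  case True
  then show ?thesis using assms by auto
next
  case False
  then have b: "b > 0" using assms by simp
  have "(K - a) / b \<le> Inf S"
    using assms(1,3) b by (intro cInf_greatest) (auto simp: field_simps)
  then show ?thesis using b by (simp add: field_simps)
qed

lemma nu_p_le: "pvar_bound p J u c \<Longrightarrow> nu_p p J u \<le> c"
  unfolding nu_p_def
  by (rule cInf_lower) (simp, rule bdd_belowI[of _ 0], simp add: pvar_bound_def)

lemma nu_p_nonneg: "u \<in> Vp p J \<Longrightarrow> 0 \<le> nu_p p J u"
  unfolding nu_p_def Vp_def by (rule cInf_greatest) (auto simp: pvar_bound_def)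

lemma Vp_norm_nonneg:
  assumes "u \<in> Vp p J" "p \<ge> 1" "J \<noteq> {}"
  shows "0 \<le> Vp_norm p J u"
proof -
  obtain a where "a \<in> J" using assms by blast
  then have "\<bar>u a\<bar> \<le> (SUP x\<in>J. \<bar>u x\<bar>)" by (rule cSUP_upper[OF _ Vp_bdd_above[OF assms(1,2)]])
  then show ?thesis using nu_p_nonneg[OF assms(1)] by (simp add: Vp_norm_def)
qed

lemma pvar_bound_cong:
  assumes "\<And>x. x \<in> J \<Longrightarrow> u x = w x"
  shows "pvar_bound p J u = pvar_bound p J w"
proof
  fix c
  have *: "pvar_bound p J w c"
    if u: "pvar_bound p J u c" and uw: "\<And>x. x \<in> J \<Longrightarrow> u x = w x" for u w
    unfolding pvar_bound_def
  proof (intro conjI allI impI)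
    fix N :: nat and t :: "nat \<Rightarrow> real"
    assume t: "t ` {..N} \<subseteq> J" "strict_mono_on {..N} t"
    have "(\<Sum>k = 1..N. \<bar>w (t k) - w (t (k - 1))\<bar> powr p) = (\<Sum>k = 1..N. \<bar>u (t k) - u (t (k - 1))\<bar> powr p)"
      using t(1) uw by (intro sum.cong) (auto simp: image_subset_iff)
    then show "(\<Sum>k = 1..N. \<bar>w (t k) - w (t (k - 1))\<bar> powr p) \<le> c powr p"
      using pvar_boundD[OF u t] by simp
  qed (use u in \<open>rule pvar_bound_pos\<close>)
  show "pvar_bound p J u c = pvar_bound p J w c" using *[of u w] *[of w u] assms by auto
qed

lemma Vp_cong: "(\<And>x. x \<in> J \<Longrightarrow> u x = w x) \<Longrightarrow> u \<in> Vp p J \<longleftrightarrow> w \<in> Vp p J"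
  by (simp add: Vp_def pvar_bound_cong[of J u w p])

lemma Vp_norm_cong: "(\<And>x. x \<in> J \<Longrightarrow> u x = w x) \<Longrightarrow> Vp_norm p J u = Vp_norm p J w"
  by (simp add: Vp_norm_def nu_p_def pvar_bound_cong[of J u w p] cong: SUP_cong)

section \<open>Composition with a differentiable function, times its derivative\<close>

lemma nonzero_derivative_imp_strict_monotone:
  fixes g d :: "real \<Rightarrow> real"
  assumes "\<And>x. x \<in> {a..b} \<Longrightarrow> (g has_real_derivative d x) (at x within {a..b})"
    and "\<And>x. x \<in> {a..b} \<Longrightarrow> d x \<noteq> 0"
  shows "strict_mono_on {a..b} g \<or> strict_antimono_on {a..b} g"
proof -
  have "g x \<noteq> g y" if "x \<in> {a..b}" "y \<in> {a..b}" "x < y" for x y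
  proof -
    have "\<exists>z\<in>{x<..<y}. g y - g x = (\<lambda>h. d z * h) (y - x)"
    proof (rule mvt_simple[where f' = "\<lambda>z h. d z * h"])
      fix z assume "x \<le> z" "z \<le> y"
      then have "(g has_real_derivative d z) (at z within {x..y})"
        using that by (intro DERIV_subset[OF assms(1)]) auto
      then show "(g has_derivative (\<lambda>h. d z * h)) (at z within {x..y})"
        by (simp add: has_field_derivative_def)
    qed (use that in simp)
    then show ?thesis using assms(2) that by fastforce
  qed
  then have "inj_on g {a..b}" by (metis inj_onI linorder_neq_iff)
  moreover have "continuous_on {a..b} g"
    using assms(1) by (meson DERIV_continuous continuous_on_eq_continuous_within)
  ultimately show ?thesis using injective_eq_monotone_map[of "{a..b}" g] by (simp add: is_interval_cc)
qed

text \<open>If \<open>d\<close> vanishes between \<open>t m\<close> and \<open>t N\<close>, take the first partition step that contains a zero.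
  When it is the very first step, the run before it consists of the single point \<open>t m\<close>, at which
  \<open>d\<close> itself may vanish.\<close>
lemma first_zero_step:
  fixes t :: "nat \<Rightarrow> real" and d :: "real \<Rightarrow> real"
  assumes "m < N" "\<exists>x\<in>{t m..t N}. d x = 0"
  obtains n z where "m < n" "n \<le> N" "t (n - 1) \<le> z" "z \<le> t n" "d z = 0"
    "m < n - 1 \<Longrightarrow> \<forall>x\<in>{t m..t (n - 1)}. d x \<noteq> 0"
proof -
  define Q where "Q n \<longleftrightarrow> m < n \<and> (\<exists>x\<in>{t m..t n}. d x = 0)" for n
  define n where "n = (LEAST n. Q n)"
  have QN: "Q N" using assms by (simp add: Q_def)
  then have Qn: "Q n" and le: "n \<le> N"
    unfolding n_def by (auto intro: LeastI Least_le)
  have min: "\<not> Q k" if "k < n" for k using that not_less_Least n_def by blast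
  obtain z where z: "z \<in> {t m..t n}" "d z = 0" using Qn Q_def by blast
  have run: "\<forall>x\<in>{t m..t (n - 1)}. d x \<noteq> 0" if "m < n - 1"
    using min[of "n - 1"] that by (auto simp: Q_def)
  have "t (n - 1) \<le> z"
  proof (cases "m < n - 1")
    case True
    then show ?thesis using run z by force
  next
    case False
    then have "n - 1 = m" using Qn unfolding Q_def by linarith
    then show ?thesis using z by simp
  qed
  then show thesis using that Qn le z run by (auto simp: Q_def)
qed

context
  fixes p cf :: real and J :: "real set" and f g d v :: "real \<Rightarrow> real" and t :: "nat \<Rightarrow> real" and N :: nat
  assumes p: "p \<ge> 1" and J: "is_interval J"
    and g: "\<And>x. x \<in> J \<Longrightarrow> (g has_real_derivative d x) (at x within J)"
    and f: "pvar_bound p (g ` J) f cf"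
    and v: "\<And>s t. s \<in> J \<Longrightarrow> t \<in> J \<Longrightarrow> s \<le> t \<Longrightarrow> \<bar>d t - d s\<bar> powr p \<le> v t - v s"
    and t: "t ` {..N} \<subseteq> J" "strict_mono_on {..N} t"
begin

text \<open>The \<open>p\<close>-th power of the weighted increment of \<open>f \<circ> g\<close> over the step from \<open>t (k - 1)\<close> to \<open>t k\<close>.\<close>
private definition wt where "wt k = min \<bar>d (t k)\<bar> \<bar>d (t (k - 1))\<bar> powr p * \<bar>f (g (t k)) - f (g (t (k - 1)))\<bar> powr p"

private lemma t_mem: "k \<le> N \<Longrightarrow> t k \<in> J" using t(1) by auto
private lemma t_mono: "i \<le> k \<Longrightarrow> k \<le> N \<Longrightarrow> t i \<le> t k"
  using strict_mono_on_leD[OF t(2), of i k] by simp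
private lemma mem_J: "i \<le> N \<Longrightarrow> k \<le> N \<Longrightarrow> t i \<le> x \<Longrightarrow> x \<le> t k \<Longrightarrow> x \<in> J"
  using J t_mem unfolding is_interval_1 by blast
private lemma v_mono: "x \<in> J \<Longrightarrow> y \<in> J \<Longrightarrow> x \<le> y \<Longrightarrow> v x \<le> v y"
  using v[of x y] by (smt (verit) powr_ge_zero)

private lemma wt_le: 
  assumes "1 \<le> k" "k \<le> N" "\<bar>d (t (k - 1))\<bar> powr p \<le> M"
  shows "wt k \<le> M * cf powr p"
proof -
  have "\<bar>f (g (t k)) - f (g (t (k - 1)))\<bar> \<le> cf"
    by (rule pvar_bound_increment[OF f p]) (use assms t_mem in auto)
  then have "\<bar>f (g (t k)) - f (g (t (k - 1)))\<bar> powr p \<le> cf powr p"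
    using p by (intro powr_mono2) auto
  moreover have "min \<bar>d (t k)\<bar> \<bar>d (t (k - 1))\<bar> powr p \<le> M"
    using p by (intro order_trans[OF powr_mono2 assms(3)]) auto
  ultimately show ?thesis unfolding wt_def
    using order_trans[OF powr_ge_zero assms(3)] by (intro mult_mono) auto
qed

text \<open>On a run without zeros of \<open>d\<close>, the points \<open>g (t k)\<close> form a monotone sequence, so the increments
  of \<open>f \<circ> g\<close> are those of \<open>f\<close> along a partition of \<open>g ` J\<close>. A run consisting of one point has an
  empty sum, and \<open>d\<close> may vanish there.\<close>
private lemma run_le:
  assumes "m \<le> n" "n \<le> N" "m < n \<Longrightarrow> \<forall>x\<in>{t m..t n}. d x \<noteq> 0"
    and M: "\<And>k. m \<le> k \<Longrightarrow> k \<le> n \<Longrightarrow> \<bar>d (t k)\<bar> powr p \<le> M"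
  shows "(\<Sum>k\<in>{m<..n}. wt k) \<le> M * cf powr p"
proof (cases "m < n")
  case True
  have M0: "0 \<le> M" using order_trans[OF powr_ge_zero M[of m]] assms(1) by simp
  have "strict_mono_on {t m..t n} g \<or> strict_antimono_on {t m..t n} g"
  proof (rule nonzero_derivative_imp_strict_monotone[where d = d])
    fix x assume "x \<in> {t m..t n}"
    show "(g has_real_derivative d x) (at x within {t m..t n})"
      using mem_J[of m n] assms(1,2) \<open>x \<in> _\<close> by (intro DERIV_subset[OF g]) auto
  qed (use assms True in auto)
  moreover have tr: "t k \<in> {t m..t n}" if "k \<in> {m..n}" for k
    using that assms(2) by (auto intro!: t_mono)
  moreover have "strict_mono_on {m..n} t"
    using t(2) assms(2) by (auto simp: strict_mono_on_def)
  ultimately have "strict_mono_on {m..n} (\<lambda>k. g (t k)) \<or> strict_antimono_on {m..n} (\<lambda>k. g (t k))"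
    unfolding monotone_on_def by blast
  moreover have "(\<lambda>k. g (t k)) ` {m..n} \<subseteq> g ` J" using t_mem assms(2) by auto
  ultimately have *: "(\<Sum>k\<in>{m<..n}. \<bar>f (g (t k)) - f (g (t (k - 1)))\<bar> powr p) \<le> cf powr p"
    using pvar_bound_sum_mono[OF f] by blast
  have "(\<Sum>k\<in>{m<..n}. wt k) \<le> (\<Sum>k\<in>{m<..n}. M * \<bar>f (g (t k)) - f (g (t (k - 1)))\<bar> powr p)"
    unfolding wt_def
  proof (intro sum_mono mult_right_mono)
    fix k assume "k \<in> {m<..n}"
    then show "min \<bar>d (t k)\<bar> \<bar>d (t (k - 1))\<bar> powr p \<le> M"
      using p M[of k] by (intro order_trans[OF powr_mono2 M[of k]]) auto
  qed simp
  also have "\<dots> \<le> M * cf powr p"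
    unfolding sum_distrib_left[symmetric] using * M0 by (rule mult_left_mono)
  finally show ?thesis .
next
  case False
  then show ?thesis using assms(1) order_trans[OF powr_ge_zero M[of m]] by simp
qed

private lemma split_step:
  assumes "m < n" "n \<le> N"
  shows "(\<Sum>k\<in>{m<..N}. wt k) = (\<Sum>k\<in>{m<..n-1}. wt k) + wt n + (\<Sum>k\<in>{n<..N}. wt k)"
proof -
  have "{m<..N} = insert n ({m<..n-1} \<union> {n<..N})" using assms by auto
  moreover have "n \<notin> {m<..n-1} \<union> {n<..N}" using assms by auto
  moreover have "{m<..n-1} \<inter> {n<..N} = {}" by auto
  ultimately show ?thesis by (simp add: sum.union_disjoint)
qed

text \<open>To the right of a zero \<open>z\<close>, the part of the partition before the next step containing a zero \<open>z'\<close>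
  and that step itself each contribute at most \<open>cf powr p\<close> times the increment of \<open>v\<close> between \<open>z\<close> and
  \<open>z'\<close>; the rest of the partition starts at or to the right of \<open>z'\<close>.\<close>
private lemma sum_le_after_zero:
  assumes "m \<le> N" "z \<in> J" "z \<le> t m" "d z = 0"
  shows "(\<Sum>k\<in>{m<..N}. wt k) \<le> 2 * (v (t N) - v z) * cf powr p"
  using assms
proof (induction "N - m" arbitrary: m z rule: less_induct)
  case less
  have peak: "\<bar>d (t k)\<bar> powr p \<le> v (t n) - v z" if "m \<le> k" "k \<le> n" "n \<le> N" for k n
  proof -
    have "z \<le> t k" using t_mono[of m k] that less.prems by simp
    then have "\<bar>d (t k)\<bar> powr p \<le> v (t k) - v z"
      using v[of z "t k"] t_mem[of k] that less.prems by simp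
    also have "v (t k) \<le> v (t n)" using that t_mem t_mono v_mono by simp
    finally show ?thesis by simp
  qed
  show ?case
  proof (cases "m < N \<and> (\<exists>x\<in>{t m..t N}. d x = 0)")
    case False
    have "(\<Sum>k\<in>{m<..N}. wt k) \<le> (v (t N) - v z) * cf powr p"
      by (rule run_le) (use False less.prems peak in auto)
    moreover have "0 \<le> v (t N) - v z" using order_trans[OF powr_ge_zero peak[of m N]] less.prems by simp
    ultimately show ?thesis by (simp add: mult_right_mono order_trans)
  next
    case True
    then obtain n z' where n: "m < n" "n \<le> N" "t (n - 1) \<le> z'" "z' \<le> t n" "d z' = 0"
      "m < n - 1 \<Longrightarrow> \<forall>x\<in>{t m..t (n - 1)}. d x \<noteq> 0"
      using first_zero_step[of m N t d] by blast
    have z': "z' \<in> J" using mem_J[of "n - 1" n] n by simp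
    have "(\<Sum>k\<in>{m<..n-1}. wt k) \<le> (v (t (n - 1)) - v z) * cf powr p"
      by (rule run_le) (use n peak[of _ "n - 1"] in auto)
    moreover have "wt n \<le> (v (t (n - 1)) - v z) * cf powr p"
      using n peak[of "n - 1" "n - 1"] by (intro wt_le) auto
    moreover have "(\<Sum>k\<in>{n<..N}. wt k) \<le> 2 * (v (t N) - v z') * cf powr p"
      using n z' by (intro less.hyps) auto
    moreover have "v (t (n - 1)) * cf powr p \<le> v z' * cf powr p"
      using n z' t_mem by (intro mult_right_mono v_mono) auto
    ultimately show ?thesis using split_step[OF n(1,2)] by (simp add: algebra_simps)
  qed
qed

text \<open>Either \<open>d\<close> has no zeros between \<open>t 0\<close> and \<open>t N\<close>, and the whole partition is one run on which \<open>\<bar>d\<bar> \<le> B\<close>; or its first run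
  is estimated through the zero to its right, and all later ones through zeros to their left.\<close>
lemma sum_weighted_increments_le:
  assumes B: "\<And>x. x \<in> J \<Longrightarrow> \<bar>d x\<bar> \<le> B" and B0: "B \<ge> 0" and "c \<ge> 0" and c: "v (t N) - v (t 0) \<le> c powr p"
  shows "(\<Sum>k = 1..N. min \<bar>d (t k)\<bar> \<bar>d (t (k - 1))\<bar> powr p * \<bar>f (g (t k)) - f (g (t (k - 1)))\<bar> powr p)
    \<le> 2 * ((B + c) powr p * cf powr p)"
proof -
  have "(\<Sum>k\<in>{0<..N}. wt k) \<le> 2 * ((B + c) powr p * cf powr p)"
  proof (cases "0 < N \<and> (\<exists>x\<in>{t 0..t N}. d x = 0)")
    case False
    have "(\<Sum>k\<in>{0<..N}. wt k) \<le> B powr p * cf powr p"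
      by (rule run_le) (use False B p t_mem in \<open>auto intro!: powr_mono2\<close>)
    also have "\<dots> \<le> (B + c) powr p * cf powr p"
      using B0 assms p by (intro mult_right_mono powr_mono2) auto
    also have "\<dots> \<le> 2 * ((B + c) powr p * cf powr p)" by simp
    finally show ?thesis .
  next
    case True
    then obtain n z where n: "0 < n" "n \<le> N" "t (n - 1) \<le> z" "z \<le> t n" "d z = 0"
      "0 < n - 1 \<Longrightarrow> \<forall>x\<in>{t 0..t (n - 1)}. d x \<noteq> 0"
      using first_zero_step[of 0 N t d] by blast
    have z: "z \<in> J" using mem_J[of "n - 1" n] n by simp
    have peak: "\<bar>d (t k)\<bar> powr p \<le> v z - v (t 0)" if "k \<le> n - 1" for k
    proof -
      have "t k \<le> z" using t_mono[of k "n - 1"] that n(2,3) by linarith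
      then have "\<bar>d (t k)\<bar> powr p \<le> v z - v (t k)"
        using v[of "t k" z] t_mem[of k] that n z by simp
      moreover have "v (t 0) \<le> v (t k)" using that n t_mem t_mono v_mono by simp
      ultimately show ?thesis by simp
    qed
    have "(\<Sum>k\<in>{0<..n-1}. wt k) \<le> (v z - v (t 0)) * cf powr p"
      by (rule run_le) (use n peak in auto)
    moreover have "wt n \<le> (v z - v (t 0)) * cf powr p"
      using n peak[of "n - 1"] by (intro wt_le) auto
    moreover have "(\<Sum>k\<in>{n<..N}. wt k) \<le> 2 * (v (t N) - v z) * cf powr p"
      using n z by (intro sum_le_after_zero) auto
    ultimately have "(\<Sum>k\<in>{0<..N}. wt k) \<le> 2 * (v (t N) - v (t 0)) * cf powr p"
      using split_step[OF n(1,2)] by (simp add: algebra_simps)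
    also have "\<dots> \<le> 2 * c powr p * cf powr p" using c by (intro mult_right_mono) auto
    also have "\<dots> \<le> 2 * (B + c) powr p * cf powr p" 
      using B0 assms p by (intro mult_right_mono mult_left_mono powr_mono2) auto
    finally show ?thesis by (simp add: mult.assoc)
  qed
  moreover have "{0<..N} = {1..N}" by auto
  ultimately show ?thesis by (simp add: wt_def)
qed

end

text \<open>The two summands of the bound belong to the increments of \<open>d\<close> and to those of \<open>f \<circ> g\<close>.\<close>
lemma pvar_bound_comp_times_deriv:
  fixes f g d :: "real \<Rightarrow> real"
  assumes p: "p \<ge> 1" and J: "is_interval J"
    and g: "\<And>x. x \<in> J \<Longrightarrow> (g has_real_derivative d x) (at x within J)"
    and f: "pvar_bound p (g ` J) f cf" and d: "pvar_bound p J d cd"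
    and A: "\<And>x. x \<in> J \<Longrightarrow> \<bar>f (g x)\<bar> \<le> A" "A \<ge> 0"
    and B: "\<And>x. x \<in> J \<Longrightarrow> \<bar>d x\<bar> \<le> B" "B \<ge> 0"
  shows "pvar_bound p J (\<lambda>x. f (g x) * d x) (A * cd + 2 powr (1/p) * cf * (B + cd))"
  unfolding pvar_bound_def
proof (intro conjI allI impI)
  have pos: "cf > 0" "cd > 0" using f d by (auto dest: pvar_bound_pos)
  define Y where "Y = 2 powr (1/p) * cf * (B + cd)"
  have Y: "Y > 0" using pos B by (auto simp: Y_def intro!: mult_pos_pos add_nonneg_pos)
  have "A * cd \<ge> 0" using A pos by simp
  then show "0 < A * cd + 2 powr (1/p) * cf * (B + cd)" using Y unfolding Y_def by simp
  obtain v where v': "\<forall>s\<in>J. \<forall>t\<in>J. s \<le> t \<longrightarrow> \<bar>d t - d s\<bar> powr p \<le> v t - v s"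
    and v_bd: "\<forall>t\<in>J. 0 \<le> v t \<and> v t \<le> cd powr p"
    using pvar_control[OF d] by blast
  have v: "\<bar>d t - d s\<bar> powr p \<le> v t - v s" if "s \<in> J" "t \<in> J" "s \<le> t" for s t
    using v' that by blast
  fix N :: nat and t :: "nat \<Rightarrow> real"
  assume t: "t ` {..N} \<subseteq> J" "strict_mono_on {..N} t"
  define y where "y k = min \<bar>d (t k)\<bar> \<bar>d (t (k - 1))\<bar> * \<bar>f (g (t k)) - f (g (t (k - 1)))\<bar>" for k
  define x where "x k = A * \<bar>d (t k) - d (t (k - 1))\<bar>" for k
  have tJ: "t k \<in> J" if "k \<le> N" for k using t(1) that by auto
  \<comment> \<open>In the product rule for increments, the factor of \<open>F - E\<close> can be chosen as whichever of
    \<open>a\<close> and \<open>b\<close> is smaller in absolute value.\<close>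
  have incr: "\<bar>F * a - E * b\<bar> \<le> A * \<bar>a - b\<bar> + min \<bar>a\<bar> \<bar>b\<bar> * \<bar>F - E\<bar>"
    if "\<bar>F\<bar> \<le> A" "\<bar>E\<bar> \<le> A" for F E a b :: real
  proof (cases "\<bar>a\<bar> \<le> \<bar>b\<bar>")
    case True
    have "F * a - E * b = E * (a - b) + a * (F - E)" by (simp add: algebra_simps)
    then have "\<bar>F * a - E * b\<bar> \<le> \<bar>E\<bar> * \<bar>a - b\<bar> + \<bar>a\<bar> * \<bar>F - E\<bar>"
      by (metis abs_mult abs_triangle_ineq)
    also have "\<bar>E\<bar> * \<bar>a - b\<bar> \<le> A * \<bar>a - b\<bar>" using that by (intro mult_right_mono) auto
    finally show ?thesis using True by simp
  next
    case False
    have "F * a - E * b = F * (a - b) + b * (F - E)" by (simp add: algebra_simps)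
    then have "\<bar>F * a - E * b\<bar> \<le> \<bar>F\<bar> * \<bar>a - b\<bar> + \<bar>b\<bar> * \<bar>F - E\<bar>"
      by (metis abs_mult abs_triangle_ineq)
    also have "\<bar>F\<bar> * \<bar>a - b\<bar> \<le> A * \<bar>a - b\<bar>" using that by (intro mult_right_mono) auto
    finally show ?thesis using False by simp
  qed
  have "(\<Sum>k = 1..N. \<bar>f (g (t k)) * d (t k) - f (g (t (k - 1))) * d (t (k - 1))\<bar> powr p)
      \<le> (\<Sum>k = 1..N. (x k + y k) powr p)"
    unfolding x_def y_def using p A(1) tJ by (intro sum_mono powr_mono2 incr) auto
  also have "\<dots> \<le> (A * cd + Y) powr p"
  proof (rule minkowski_sum_le)
    show "(\<Sum>k = 1..N. x k powr p) \<le> (A * cd) powr p"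
      using mult_left_mono[OF pvar_boundD[OF d t], of "A powr p"] A(2) pos
      by (simp add: x_def powr_mult sum_distrib_left)
    have "v (t N) - v (t 0) \<le> cd powr p" using v_bd[rule_format, of "t 0"] v_bd[rule_format, of "t N"] tJ by simp
    then have "(\<Sum>k = 1..N. y k powr p) \<le> 2 * ((B + cd) powr p * cf powr p)"
      using sum_weighted_increments_le[OF p J g f v t B(1,2), of cd] pos
      by (simp add: y_def powr_mult)
    also have "\<dots> = Y powr p"
      using p pos B(2) by (simp add: Y_def powr_mult powr_powr)
    finally show "(\<Sum>k = 1..N. y k powr p) \<le> Y powr p" .
  qed (use p A pos Y in \<open>auto simp: x_def y_def\<close>)
  finally show "(\<Sum>k = 1..N. \<bar>f (g (t k)) * d (t k) - f (g (t (k - 1))) * d (t (k - 1))\<bar> powr p)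
    \<le> (A * cd + 2 powr (1/p) * cf * (B + cd)) powr p" unfolding Y_def .
qed

text \<open>The interval \<open>J\<close> may be a single point; then \<open>g\<close> has every number as derivative within \<open>J\<close>.\<close>
lemma Vp_norm_comp_times_deriv_le:
  fixes f g d :: "real \<Rightarrow> real"
  assumes p: "p \<ge> 1" and J: "is_interval J" "J \<noteq> {}"
    and g: "\<And>x. x \<in> J \<Longrightarrow> (g has_real_derivative d x) (at x within J)"
    and f: "f \<in> Vp p (g ` J)" and d: "d \<in> Vp p J"
  shows "(\<lambda>x. f (g x) * d x) \<in> Vp p J"
    and "Vp_norm p J (\<lambda>x. f (g x) * d x) \<le> 2 powr (1/p) * Vp_norm p (g ` J) f * Vp_norm p J d"
proof -
  define A where "A = (SUP y\<in>g ` J. \<bar>f y\<bar>)"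
  define B where "B = (SUP x\<in>J. \<bar>d x\<bar>)"
  define w where "w = (\<lambda>x. f (g x) * d x)"
  define q :: real where "q = 2 powr (1/p)"
  have A: "\<bar>f (g x)\<bar> \<le> A" if "x \<in> J" for x
    unfolding A_def using that by (intro cSUP_upper[OF _ Vp_bdd_above[OF f p]]) auto
  have B: "\<bar>d x\<bar> \<le> B" if "x \<in> J" for x
    unfolding B_def using that by (intro cSUP_upper[OF _ Vp_bdd_above[OF d p]]) auto
  have AB: "A \<ge> 0" "B \<ge> 0" using order_trans[OF abs_ge_zero A] order_trans[OF abs_ge_zero B] J(2) by auto
  have q: "q \<ge> 1" unfolding q_def using p by (simp add: ge_one_powr_ge_zero)
  have bound: "pvar_bound p J w (A * cd + q * cf * (B + cd))"
    if "pvar_bound p (g ` J) f cf" "pvar_bound p J d cd" for cf cd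
    unfolding w_def q_def using pvar_bound_comp_times_deriv[OF p J(1) g that A AB(1) B AB(2)] by simp
  have nef: "{c. pvar_bound p (g ` J) f c} \<noteq> {}" and ned: "{c. pvar_bound p J d c} \<noteq> {}"
    using f d by (auto simp: Vp_def)
  show w: "(\<lambda>x. f (g x) * d x) \<in> Vp p J"
    using bound nef ned unfolding w_def Vp_def by blast
  \<comment> \<open>The bound is affine in each of \<open>cf\<close> and \<open>cd\<close>, so both can be replaced by their infima.\<close>
  have nu: "nu_p p J w \<le> A * nu_p p J d + q * nu_p p (g ` J) f * (B + nu_p p J d)"
  proof -
    have *: "nu_p p J w \<le> A * cd + (q * (B + cd)) * nu_p p (g ` J) f" if "pvar_bound p J d cd" for cd
      unfolding nu_p_def[of p "g ` J"]
    proof (rule le_affine_cInf[OF nef])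
      show "0 \<le> q * (B + cd)" using q AB pvar_bound_pos[OF that] by simp
      show "nu_p p J w \<le> A * cd + q * (B + cd) * c" if "c \<in> {c. pvar_bound p (g ` J) f c}" for c
        using nu_p_le[OF bound[OF _ \<open>pvar_bound p J d cd\<close>, of c]] that by (simp add: mult_ac)
    qed
    have "nu_p p J w \<le> q * B * nu_p p (g ` J) f + (A + q * nu_p p (g ` J) f) * nu_p p J d"
      unfolding nu_p_def[of p J d]
    proof (rule le_affine_cInf[OF ned])
      show "0 \<le> A + q * nu_p p (g ` J) f" using AB q nu_p_nonneg[OF f] by simp
      show "nu_p p J w \<le> q * B * nu_p p (g ` J) f + (A + q * nu_p p (g ` J) f) * c"
        if "c \<in> {c. pvar_bound p J d c}" for c
        using *[of c] that by (simp add: algebra_simps)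
    qed
    then show ?thesis by (simp add: algebra_simps)
  qed
  have sup: "(SUP x\<in>J. \<bar>w x\<bar>) \<le> A * B"
    using J(2) A B AB unfolding w_def by (intro cSUP_least) (auto simp: abs_mult intro: mult_mono)
  have nn: "0 \<le> nu_p p (g ` J) f" "0 \<le> nu_p p J d" using f d by (auto intro: nu_p_nonneg)
  have "(SUP x\<in>J. \<bar>w x\<bar>) + nu_p p J w \<le> A * (B + nu_p p J d) + q * (nu_p p (g ` J) f * (B + nu_p p J d))"
    using sup nu by (simp add: algebra_simps)
  also have "\<dots> \<le> q * (A * (B + nu_p p J d)) + q * (nu_p p (g ` J) f * (B + nu_p p J d))"
  proof -
    have "1 * (A * (B + nu_p p J d)) \<le> q * (A * (B + nu_p p J d))"
      using q AB nn by (intro mult_right_mono) auto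
    then show ?thesis by simp
  qed
  also have "\<dots> = q * (A + nu_p p (g ` J) f) * (B + nu_p p J d)" by (simp add: algebra_simps)
  finally show "Vp_norm p J (\<lambda>x. f (g x) * d x) \<le> 2 powr (1/p) * Vp_norm p (g ` J) f * Vp_norm p J d"
    by (simp add: Vp_norm_def w_def A_def B_def q_def)
qed

section \<open>Indefinite integrals of functions of bounded p-variation\<close>

text \<open>A function of bounded \<open>p\<close>-variation is continuous wherever its monotone control function is,
  that is, outside a countable set; hence it is measurable.\<close>
lemma pvar_bound_set_integrable:
  fixes h :: "real \<Rightarrow> real"
  assumes "p \<ge> 1" "pvar_bound p {a..b} h c" "a \<le> b"
  shows "set_integrable lborel {a..b} h"
proof -
  obtain v where "\<forall>s\<in>{a..b}. \<forall>t\<in>{a..b}. s \<le> t \<longrightarrow> \<bar>h t - h s\<bar> powr p \<le> v t - v s"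
    using pvar_control[OF assms(2)] by blast
  then have v: "\<bar>h t - h s\<bar> powr p \<le> v t - v s" if "s \<in> {a..b}" "t \<in> {a..b}" "s \<le> t" for s t
    using that by blast
  \<comment> \<open>Projecting onto \<open>{a..b}\<close> extends \<open>h\<close> and \<open>v\<close> constantly to the whole line.\<close>
  define \<pi> where "\<pi> x = max a (min b x)" for x
  have \<pi>: "\<pi> x \<in> {a..b}" for x using assms(3) by (auto simp: \<pi>_def)
  have \<pi>_id: "\<pi> x = x" if "x \<in> {a..b}" for x using that by (auto simp: \<pi>_def)
  have \<pi>_mono: "\<pi> x \<le> \<pi> y" if "x \<le> y" for x y using that by (auto simp: \<pi>_def)
  have step: "\<bar>h (\<pi> y) - h (\<pi> x)\<bar> powr p \<le> \<bar>v (\<pi> y) - v (\<pi> x)\<bar>" for x y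
  proof (cases "x \<le> y")
    case True
    then show ?thesis using v[OF \<pi> \<pi> \<pi>_mono[OF True]] by linarith
  next
    case False
    then have "y \<le> x" by simp
    then show ?thesis using v[OF \<pi> \<pi> \<pi>_mono[OF \<open>y \<le> x\<close>]] abs_minus_commute[of "h (\<pi> y)"] by simp
  qed
  have "mono (\<lambda>x. v (\<pi> x))"
  proof
    fix x y :: real assume "x \<le> y"
    show "v (\<pi> x) \<le> v (\<pi> y)"
      using order_trans[OF powr_ge_zero v[OF \<pi> \<pi> \<pi>_mono[OF \<open>x \<le> y\<close>]]] by simp
  qed
  then have count: "countable {x. \<not> isCont (\<lambda>x. v (\<pi> x)) x}"
    by (rule mono_ctble_discont)
  have cont: "isCont (\<lambda>x. h (\<pi> x)) x" if x: "isCont (\<lambda>x. v (\<pi> x)) x" for x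
    unfolding isCont_def tendsto_iff
  proof (intro allI impI)
    fix e :: real assume e: "e > 0"
    then have "\<forall>\<^sub>F y in at x. dist (v (\<pi> y)) (v (\<pi> x)) < e powr p"
      using x unfolding isCont_def tendsto_iff by simp
    then show "\<forall>\<^sub>F y in at x. dist (h (\<pi> y)) (h (\<pi> x)) < e"
    proof (rule eventually_mono)
      fix y assume "dist (v (\<pi> y)) (v (\<pi> x)) < e powr p"
      then have "\<bar>h (\<pi> y) - h (\<pi> x)\<bar> powr p < e powr p"
        using step[where x = x and y = y] by (simp add: dist_real_def)
      then show "dist (h (\<pi> y)) (h (\<pi> x)) < e"
        using powr_mono2[of p e "\<bar>h (\<pi> y) - h (\<pi> x)\<bar>"] e assms(1) by (force simp: dist_real_def)
    qed
  qed
  have "(\<lambda>x. h (\<pi> x)) \<in> borel_measurable borel"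
    by (rule borel_measurable_continuous_countable_exceptions[OF count])
      (use cont in \<open>auto intro: continuous_at_imp_continuous_on\<close>)
  moreover have "norm (h (\<pi> x)) \<le> \<bar>h a\<bar> + c" for x
    using pvar_bound_increment[OF assms(2,1) \<pi>, of a x] assms(3) by simp
  ultimately have "integrable lborel (\<lambda>x. indicator {a..b} x *\<^sub>R h (\<pi> x))"
    by (intro integrableI_bounded_set_indicator[where B = "\<bar>h a\<bar> + c"])
      (auto simp: emeasure_lborel_Icc_eq)
  moreover have "indicator {a..b} x *\<^sub>R h (\<pi> x) = indicator {a..b} x *\<^sub>R h x" for x
    using \<pi>_id[of x] by (cases "x \<in> {a..b}") auto
  ultimately show ?thesis unfolding set_integrable_def by (simp only:)
qed

lemma interval_integral_diff_eq:
  fixes h :: "real \<Rightarrow> real"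
  assumes int: "\<And>a b. a \<in> I \<Longrightarrow> b \<in> I \<Longrightarrow> a \<le> b \<Longrightarrow> set_integrable lborel {a..b} h"
    and "a \<in> I" "b \<in> I" "t0 \<in> I" "a \<le> b"
  shows "(LBINT x=t0..b. h x) - (LBINT x=t0..a. h x) = integral {a..b} h"
proof -
  define l where "l = min t0 a"
  define r where "r = max t0 b"
  have lr: "l \<in> I" "r \<in> I" "l \<le> r" "min t0 (min a b) = l" "max t0 (max a b) = r"
    using assms by (auto simp: l_def r_def min_def max_def)
  have "interval_lebesgue_integrable lborel (ereal l) (ereal r) h"
    using int[OF lr(1-3)] lr(3)
    by (simp add: interval_lebesgue_integrable_def set_integrable_subset[OF int[OF lr(1-3)]]
        einterval_eq greaterThanLessThan_subseteq_atLeastAtMost_iff)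
  then have "(LBINT x=t0..a. h x) + (LBINT x=a..b. h x) = (LBINT x=t0..b. h x)"
    by (intro interval_integral_sum) (use lr(4,5) in \<open>auto simp: min_def max_def split: if_splits\<close>)
  moreover have "(LBINT x=a..b. h x) = integral {a..b} h"
    using int[OF assms(2,3,5)] assms(5) by (rule interval_integral_eq_integral[rotated])
  ultimately show ?thesis by simp
qed

text \<open>The control function \<open>v\<close> of \<open>h\<close> is monotone and bounded, so it increases by less than
  \<open>\<epsilon> powr p\<close> on a suitable interval to the right of \<open>x\<close>, and similarly to the left.\<close>
lemma Vp_oscillation_right:
  assumes "p \<ge> 1" "h \<in> Vp p I" "is_interval I" "x \<in> I" "I \<inter> {x<..} \<noteq> {}" "\<epsilon> > 0"
  shows "\<exists>y\<in>I. x < y \<and> (\<forall>s\<in>{x<..<y}. \<forall>s'\<in>{x<..<y}. \<bar>h s - h s'\<bar> \<le> \<epsilon>)"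
proof -
  obtain c where c: "pvar_bound p I h c" using assms(2) unfolding Vp_def by blast
  obtain v where "\<forall>s\<in>I. \<forall>t\<in>I. s \<le> t \<longrightarrow> \<bar>h t - h s\<bar> powr p \<le> v t - v s"
    and v_bd: "\<forall>t\<in>I. 0 \<le> v t \<and> v t \<le> c powr p"
    using pvar_control[OF c] by blast
  then have v: "\<bar>h t - h s\<bar> powr p \<le> v t - v s" if "s \<in> I" "t \<in> I" "s \<le> t" for s t
    using that by blast
  define L where "L = Inf (v ` (I \<inter> {x<..}))"
  have bdd: "bdd_below (v ` (I \<inter> {x<..}))" using v_bd by (auto intro!: bdd_belowI2)
  have "\<exists>z\<in>v ` (I \<inter> {x<..}). z < L + \<epsilon> powr p"
    using cInf_lessD[of "v ` (I \<inter> {x<..})" "L + \<epsilon> powr p"] assms(5,6) unfolding L_def by auto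
  then obtain y where y: "y \<in> I" "x < y" "v y < L + \<epsilon> powr p" by auto
  have mem: "s \<in> I" if "s \<in> {x<..<y}" for s
    using that y assms(3,4) unfolding is_interval_1 by (meson greaterThanLessThan_iff less_imp_le)
  have *: "\<bar>h s' - h s\<bar> \<le> \<epsilon>" if "s \<in> {x<..<y}" "s' \<in> {x<..<y}" "s \<le> s'" for s s'
  proof -
    have "L \<le> v s" unfolding L_def using that mem by (intro cInf_lower[OF _ bdd]) auto
    moreover have "v s' \<le> v y"
      using order_trans[OF powr_ge_zero v[of s' y]] that mem y by simp
    ultimately have "\<bar>h s' - h s\<bar> powr p < \<epsilon> powr p"
      using v[of s s'] that mem y by simp
    then show ?thesis
      using powr_mono2[of p \<epsilon> "\<bar>h s' - h s\<bar>"] assms(1,6) by linarith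
  qed
  have "\<bar>h s - h s'\<bar> \<le> \<epsilon>" if "s \<in> {x<..<y}" "s' \<in> {x<..<y}" for s s'
    using *[of s s'] *[of s' s] that by (cases "s \<le> s'") (auto simp: abs_minus_commute)
  then show ?thesis using y by blast
qed

lemma Vp_oscillation_left:
  assumes "p \<ge> 1" "h \<in> Vp p I" "is_interval I" "x \<in> I" "I \<inter> {..<x} \<noteq> {}" "\<epsilon> > 0"
  shows "\<exists>y\<in>I. y < x \<and> (\<forall>s\<in>{y<..<x}. \<forall>s'\<in>{y<..<x}. \<bar>h s - h s'\<bar> \<le> \<epsilon>)"
proof -
  obtain c where c: "pvar_bound p I h c" using assms(2) unfolding Vp_def by blast
  obtain v where "\<forall>s\<in>I. \<forall>t\<in>I. s \<le> t \<longrightarrow> \<bar>h t - h s\<bar> powr p \<le> v t - v s"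
    and v_bd: "\<forall>t\<in>I. 0 \<le> v t \<and> v t \<le> c powr p"
    using pvar_control[OF c] by blast
  then have v: "\<bar>h t - h s\<bar> powr p \<le> v t - v s" if "s \<in> I" "t \<in> I" "s \<le> t" for s t
    using that by blast
  define L where "L = Sup (v ` (I \<inter> {..<x}))"
  have bdd: "bdd_above (v ` (I \<inter> {..<x}))" using v_bd by (auto intro!: bdd_aboveI2)
  have "\<exists>z\<in>v ` (I \<inter> {..<x}). L - \<epsilon> powr p < z"
    using less_cSupD[of "v ` (I \<inter> {..<x})" "L - \<epsilon> powr p"] assms(5,6) unfolding L_def by auto
  then obtain y where y: "y \<in> I" "y < x" "L - \<epsilon> powr p < v y" by auto
  have mem: "s \<in> I" if "s \<in> {y<..<x}" for s
    using that y assms(3,4) unfolding is_interval_1 by (meson greaterThanLessThan_iff less_imp_le)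
  have *: "\<bar>h s' - h s\<bar> \<le> \<epsilon>" if "s \<in> {y<..<x}" "s' \<in> {y<..<x}" "s \<le> s'" for s s'
  proof -
    have "v s' \<le> L" unfolding L_def using that mem by (intro cSup_upper[OF _ bdd]) auto
    moreover have "v y \<le> v s"
      using order_trans[OF powr_ge_zero v[of y s]] that mem y by simp
    ultimately have "\<bar>h s' - h s\<bar> powr p < \<epsilon> powr p"
      using v[of s s'] that mem y by simp
    then show ?thesis
      using powr_mono2[of p \<epsilon> "\<bar>h s' - h s\<bar>"] assms(1,6) by linarith
  qed
  have "\<bar>h s - h s'\<bar> \<le> \<epsilon>" if "s \<in> {y<..<x}" "s' \<in> {y<..<x}" for s s'
    using *[of s s'] *[of s' s] that by (cases "s \<le> s'") (auto simp: abs_minus_commute)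
  then show ?thesis using y by blast
qed

lemma average_near_value:
  fixes h :: "real \<Rightarrow> real"
  assumes "a < b" "h integrable_on {a..b}" "\<And>r. r \<in> {a<..<b} \<Longrightarrow> \<bar>h r - c\<bar> \<le> \<epsilon>" "\<epsilon> > 0"
  shows "\<bar>integral {a..b} h / (b - a) - c\<bar> \<le> \<epsilon>"
proof -
  have "((\<lambda>r. h r - c) has_integral (integral {a..b} h - c * (b - a))) {a..b}"
    using has_integral_diff[OF integrable_integral[OF assms(2)] has_integral_const_real[of c a b]]
      assms(1) by (simp add: mult.commute)
  then have "\<bar>integral {a..b} h - c * (b - a)\<bar> \<le> \<epsilon> * (b - a)"
    using has_integral_bound_real[of \<epsilon> "{a, b}" "\<lambda>r. h r - c" _ a b] assms by force
  moreover have "integral {a..b} h / (b - a) - c = (integral {a..b} h - c * (b - a)) / (b - a)"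
    using assms(1) by (simp add: field_simps)
  ultimately show ?thesis using assms(1) by (simp add: divide_le_eq)
qed

text \<open>The existence of the limit is part of the conclusion, and the value \<open>h x\<close> does not matter.\<close>
lemma Vp_integrand_tendsto_derivative:
  fixes h G :: "real \<Rightarrow> real"
  assumes p: "p \<ge> 1" and I: "is_interval I" and h: "h \<in> Vp p I" and t0: "t0 \<in> I"
    and G: "\<And>t. t \<in> I \<Longrightarrow> G t = \<alpha> + (LBINT x=t0..t. h x)"
    and x: "x \<in> I" and D: "(G has_real_derivative D) (at x within I)"
  shows "(h \<longlongrightarrow> D) (at x within I)"
proof -
  obtain c where c: "pvar_bound p I h c" using h unfolding Vp_def by blast
  have sub: "{a..b} \<subseteq> I" if "a \<in> I" "b \<in> I" for a b
    using I that unfolding is_interval_1 by (meson atLeastAtMost_iff subsetI)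
  have int: "set_integrable lborel {a..b} h" if "a \<in> I" "b \<in> I" "a \<le> b" for a b
    using pvar_bound_set_integrable[OF p pvar_bound_subset[OF c sub[OF that(1,2)]] that(3)] .
  have diff: "G b - G a = integral {a..b} h" if "a \<in> I" "b \<in> I" "a \<le> b" for a b
    using interval_integral_diff_eq[OF int that(1,2) t0 that(3)] G that by simp
  have quot: "\<bar>(G t - G x) / (t - x) - k\<bar> \<le> \<epsilon>"
    if "t \<in> I" "t \<noteq> x" "\<And>r. r \<in> {x<..<t} \<union> {t<..<x} \<Longrightarrow> \<bar>h r - k\<bar> \<le> \<epsilon>" "\<epsilon> > 0" for t k \<epsilon>
  proof (cases "x < t")
    case True
    then have "h integrable_on {x..t}"
      using set_borel_integral_eq_integral(1)[OF int[of x t]] that x by simp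
    then show ?thesis
      using average_near_value[of x t h k \<epsilon>] True that x diff[of x t] by simp
  next
    case False
    then have "t < x" using that by simp
    then have "h integrable_on {t..x}"
      using set_borel_integral_eq_integral(1)[OF int[of t x]] that x by simp
    moreover have "(G t - G x) / (t - x) = (G x - G t) / (x - t)"
      by (metis minus_diff_eq minus_divide_divide)
    ultimately show ?thesis
      using average_near_value[of t x h k \<epsilon>] \<open>t < x\<close> that x diff[of t x] by simp
  qed
  \<comment> \<open>If \<open>h\<close> oscillates by at most \<open>\<epsilon>\<close> on a one-sided neighbourhood \<open>S\<close> of \<open>x\<close>, then the
    difference quotients of \<open>G\<close> from \<open>x\<close> to points of \<open>S\<close> differ by at most \<open>\<epsilon>\<close> from each value of \<open>h\<close>
    on \<open>S\<close>, and so does their limit \<open>D\<close>. One of the two intervals in \<open>S\<close> is empty.\<close>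
  have near: "\<bar>h s - D\<bar> \<le> \<epsilon>"
    if S: "S = {x<..<y} \<union> {y<..<x}" and "y \<in> I" "\<epsilon> > 0" "s \<in> S"
      and osc: "\<forall>s\<in>S. \<forall>s'\<in>S. \<bar>h s - h s'\<bar> \<le> \<epsilon>" for S s y \<epsilon>
  proof -
    have SI: "S \<subseteq> I" using sub[OF x \<open>y \<in> I\<close>] sub[OF \<open>y \<in> I\<close> x] S by fastforce
    have "((\<lambda>t. (G t - G x) / (t - x)) \<longlongrightarrow> D) (at x within S)"
      using DERIV_subset[OF D SI] by (simp add: has_field_derivative_iff)
    then have "((\<lambda>t. \<bar>(G t - G x) / (t - x) - h s\<bar>) \<longlongrightarrow> \<bar>D - h s\<bar>) (at x within S)"
      by (intro tendsto_intros)
    moreover have "\<forall>\<^sub>F t in at x within S. \<bar>(G t - G x) / (t - x) - h s\<bar> \<le> \<epsilon>"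
      unfolding eventually_at_filter
    proof (intro always_eventually allI impI)
      fix t assume t: "t \<noteq> x" "t \<in> S"
      show "\<bar>(G t - G x) / (t - x) - h s\<bar> \<le> \<epsilon>"
      proof (rule quot)
        fix r assume "r \<in> {x<..<t} \<union> {t<..<x}"
        then have "r \<in> S" using t S by auto
        then show "\<bar>h r - h s\<bar> \<le> \<epsilon>" using osc \<open>s \<in> S\<close> by blast
      qed (use t SI \<open>\<epsilon> > 0\<close> in auto)
    qed
    moreover have "at x within S \<noteq> bot"
    proof (cases "x < y")
      case True
      then have "S = {x<..<y}" using S by auto
      then show ?thesis using True by (simp add: trivial_limit_within islimpt_greaterThanLessThan1)
    next
      case False
      then have "S = {y<..<x}" "y < x" using S \<open>s \<in> S\<close> by auto
      then show ?thesis by (simp add: trivial_limit_within islimpt_greaterThanLessThan2)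
    qed
    ultimately have "\<bar>D - h s\<bar> \<le> \<epsilon>" using tendsto_upperbound by blast
    then show ?thesis by (simp add: abs_minus_commute)
  qed
  have right: "\<exists>y>x. \<forall>s\<in>I \<inter> {x<..<y}. \<bar>h s - D\<bar> \<le> \<epsilon>" if "\<epsilon> > 0" for \<epsilon>
  proof (cases "I \<inter> {x<..} = {}")
    case True
    then show ?thesis by (intro exI[of _ "x + 1"]) auto
  next
    case False
    then obtain y where y: "y \<in> I" "x < y" "\<forall>s\<in>{x<..<y}. \<forall>s'\<in>{x<..<y}. \<bar>h s - h s'\<bar> \<le> \<epsilon>"
      using Vp_oscillation_right[OF p h I x _ \<open>\<epsilon> > 0\<close>] by blast
    then have "\<bar>h s - D\<bar> \<le> \<epsilon>" if "s \<in> {x<..<y}" for s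
      using near[of "{x<..<y}" y \<epsilon> s] \<open>\<epsilon> > 0\<close> that by simp
    then show ?thesis using y by blast
  qed
  have left: "\<exists>y<x. \<forall>s\<in>I \<inter> {y<..<x}. \<bar>h s - D\<bar> \<le> \<epsilon>" if "\<epsilon> > 0" for \<epsilon>
  proof (cases "I \<inter> {..<x} = {}")
    case True
    then show ?thesis by (intro exI[of _ "x - 1"]) auto
  next
    case False
    then obtain y where y: "y \<in> I" "y < x" "\<forall>s\<in>{y<..<x}. \<forall>s'\<in>{y<..<x}. \<bar>h s - h s'\<bar> \<le> \<epsilon>"
      using Vp_oscillation_left[OF p h I x _ \<open>\<epsilon> > 0\<close>] by blast
    then have "\<bar>h s - D\<bar> \<le> \<epsilon>" if "s \<in> {y<..<x}" for s
      using near[of "{y<..<x}" y \<epsilon> s] \<open>\<epsilon> > 0\<close> that by simp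
    then show ?thesis using y by blast
  qed
  show ?thesis
    unfolding Lim_within
  proof (intro allI impI)
    fix e :: real assume "e > 0"
    then obtain y z where y: "y > x" "\<forall>s\<in>I \<inter> {x<..<y}. \<bar>h s - D\<bar> \<le> e / 2"
      and z: "z < x" "\<forall>s\<in>I \<inter> {z<..<x}. \<bar>h s - D\<bar> \<le> e / 2"
      using right[of "e / 2"] left[of "e / 2"] by auto
    have "dist (h s) D < e" if "s \<in> I" "0 < dist s x" "dist s x < min (y - x) (x - z)" for s
    proof -
      have "s \<in> I \<inter> {x<..<y} \<or> s \<in> I \<inter> {z<..<x}"
        using that by (auto simp: dist_real_def)
      then have "\<bar>h s - D\<bar> \<le> e / 2" using y z by blast
      then show ?thesis using \<open>e > 0\<close> by (simp add: dist_real_def)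
    qed
    then show "\<exists>d>0. \<forall>s\<in>I. 0 < dist s x \<and> dist s x < d \<longrightarrow> dist (h s) D < e"
      using y(1) z(1) by (intro exI[of _ "min (y - x) (x - z)"]) auto
  qed
qed

section \<open>Chains of compositions\<close>

lemma comp_chain_empty [simp]: "comp_chain g (Suc n) n = id"
  by (simp add: comp_chain_def)

lemma comp_chain_first: "i \<le> n \<Longrightarrow> comp_chain g i n = g i \<circ> comp_chain g (Suc i) n"
  by (simp add: comp_chain_def upt_conv_Cons del: upt_Suc)

lemma comp_chain_last:
  assumes "i \<le> Suc n"
  shows "comp_chain g i (Suc n) = comp_chain g i n \<circ> g (Suc n)"
proof -
  have "foldr (\<circ>) xs h = foldr (\<circ>) xs id \<circ> h" for xs :: "(real \<Rightarrow> real) list" and h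
    by (induction xs) (auto simp: o_assoc)
  from this[of "map g [i..<Suc n]" "g (Suc n)"] show ?thesis
    using assms by (simp add: comp_chain_def upt_Suc_append[of i "Suc n"] del: upt_Suc)
qed

lemma comp_chain_has_derivative:
  fixes g d :: "nat \<Rightarrow> real \<Rightarrow> real"
  assumes maps: "\<And>k. 1 \<le> k \<Longrightarrow> k \<le> n \<Longrightarrow> g k \<in> S k \<rightarrow> S (k - 1)"
    and deriv: "\<And>k x. 1 \<le> k \<Longrightarrow> k \<le> n \<Longrightarrow> x \<in> S k \<Longrightarrow> (g k has_real_derivative d k x) (at x within S k)"
    and i: "1 \<le> i" "i \<le> Suc n"
  shows "comp_chain g i n ` S n \<subseteq> S (i - 1) \<and>
    (\<forall>x\<in>S n. (comp_chain g i n has_real_derivative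
      (\<Prod>k = i..n. d k (comp_chain g (Suc k) n x))) (at x within S n))"
  using i(2)
proof (induction i rule: inc_induct)
  case base
  show ?case by (simp add: id_def)
next
  case (step m)
  have m: "1 \<le> m" "m \<le> n" using step i(1) by auto
  have sub: "comp_chain g (Suc m) n ` S n \<subseteq> S m" using step.IH by simp
  show ?case
  proof (intro conjI ballI)
    show "comp_chain g m n ` S n \<subseteq> S (m - 1)"
      using sub maps[OF m] by (auto simp: comp_chain_first[OF m(2)])
    fix x assume x: "x \<in> S n"
    have "(g m \<circ> comp_chain g (Suc m) n has_real_derivative
        d m (comp_chain g (Suc m) n x) * (\<Prod>k = Suc m..n. d k (comp_chain g (Suc k) n x))) (at x within S n)"
    proof (rule DERIV_image_chain)
      show "(g m has_real_derivative d m (comp_chain g (Suc m) n x))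
          (at (comp_chain g (Suc m) n x) within comp_chain g (Suc m) n ` S n)"
        using sub x by (intro DERIV_subset[OF deriv[OF m]]) auto
    qed (use step.IH x in blast)
    then show "(comp_chain g m n has_real_derivative
        (\<Prod>k = m..n. d k (comp_chain g (Suc k) n x))) (at x within S n)"
      using m(2) by (simp add: comp_chain_first prod.atLeast_Suc_atMost)
  qed
qed

text \<open>Iteration of \<open>Vp_norm_comp_times_deriv_le\<close> over the functions \<open>g (a + 1), \<dots>, g m\<close>, where
  the induction on \<open>m\<close> adds the innermost function last. Allowing any \<open>a\<close> covers both estimates of the theorem: \<open>a = 0\<close> with \<open>u = f\<close>,
  and \<open>a = 1\<close> with \<open>u\<close> the derivative of \<open>g 1\<close>.\<close>
lemma Vp_norm_comp_chain_times_prod_le: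
  fixes g d :: "nat \<Rightarrow> real \<Rightarrow> real" and u :: "real \<Rightarrow> real"
  assumes p: "p \<ge> 1" and "a \<le> m"
    and J: "\<And>k. a < k \<Longrightarrow> k \<le> m \<Longrightarrow> is_interval (J k)" "\<And>k. a < k \<Longrightarrow> k \<le> m \<Longrightarrow> J k \<noteq> {}"
      "\<And>k. a < k \<Longrightarrow> k \<le> m \<Longrightarrow> J (k - 1) = g k ` J k"
    and g: "\<And>k x. a < k \<Longrightarrow> k \<le> m \<Longrightarrow> x \<in> J k \<Longrightarrow> (g k has_real_derivative d k x) (at x within J k)"
    and d: "\<And>k. a < k \<Longrightarrow> k \<le> m \<Longrightarrow> d k \<in> Vp p (J k)"
    and u: "u \<in> Vp p (J a)"
  shows "(\<lambda>t. u (comp_chain g (Suc a) m t) * (\<Prod>i = Suc a..m. d i (comp_chain g (Suc i) m t))) \<in> Vp p (J m) \<and>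
    Vp_norm p (J m) (\<lambda>t. u (comp_chain g (Suc a) m t) * (\<Prod>i = Suc a..m. d i (comp_chain g (Suc i) m t)))
      \<le> 2 powr (real (m - a) / p) * Vp_norm p (J a) u * (\<Prod>k = Suc a..m. Vp_norm p (J k) (d k))"
  using assms(2-)
proof (induction m rule: dec_induct)
  case base
  then show ?case by simp
next
  case (step m)
  define W where "W m = (\<lambda>t. u (comp_chain g (Suc a) m t) * (\<Prod>i = Suc a..m. d i (comp_chain g (Suc i) m t)))" for m
  define c where "c m = 2 powr (real (m - a) / p) * Vp_norm p (J a) u * (\<Prod>k = Suc a..m. Vp_norm p (J k) (d k))" for m
  have IH: "W m \<in> Vp p (J m)" "Vp_norm p (J m) (W m) \<le> c m"
    using step.IH[OF step.prems] unfolding W_def c_def by auto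
  have Jm: "g (Suc m) ` J (Suc m) = J m" using step.prems(3)[of "Suc m"] step.hyps by simp
  have k: "a < Suc m" "Suc m \<le> Suc m" using step.hyps by auto
  have W: "W (Suc m) = (\<lambda>t. W m (g (Suc m) t) * d (Suc m) t)"
    unfolding W_def using step.hyps by (auto simp: comp_chain_last mult.assoc intro!: prod.cong)
  note main = Vp_norm_comp_times_deriv_le[OF p step.prems(1,2)[OF k] step.prems(4)[OF k], of "W m",
      unfolded Jm, OF _ IH(1) step.prems(5)[OF k]]
  have "W (Suc m) \<in> Vp p (J (Suc m))" using main(1) unfolding W by blast
  moreover have "Vp_norm p (J (Suc m)) (W (Suc m)) \<le> c (Suc m)"
  proof -
    have "Vp_norm p (J (Suc m)) (W (Suc m))
        \<le> 2 powr (1 / p) * Vp_norm p (J m) (W m) * Vp_norm p (J (Suc m)) (d (Suc m))"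
      using main(2) unfolding W by blast
    also have "\<dots> \<le> 2 powr (1 / p) * c m * Vp_norm p (J (Suc m)) (d (Suc m))"
      using IH(2) Vp_norm_nonneg[OF step.prems(5)[OF k] p step.prems(2)[OF k]]
      by (intro mult_right_mono mult_left_mono) auto
    also have "\<dots> = c (Suc m)"
      using step.hyps by (simp add: c_def powr_add[symmetric] Suc_diff_le add_divide_distrib)
    finally show ?thesis .
  qed
  ultimately show ?case unfolding W_def c_def by blast
qed

lemma at_within_nondegenerate_interval:
  fixes S :: "real set"
  assumes "is_interval S" "\<exists>a\<in>S. \<exists>b\<in>S. a < b" "x \<in> S"
  shows "at x within S \<noteq> bot"
proof -
  have "S \<noteq> {y}" for y using assms(2) by fastforce
  then show ?thesis
    using connected_imp_perfect[OF is_interval_connected[OF assms(1)] assms(3)]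
    by (simp add: trivial_limit_within)
qed

theorem theorem2p4p2:
  fixes p \<alpha> t0 :: real and n :: nat
    and Is :: "nat \<Rightarrow> real set" and I :: "real set" and J :: "nat \<Rightarrow> real set"
    and g :: "nat \<Rightarrow> real \<Rightarrow> real" and f h :: "real \<Rightarrow> real"
  assumes "p \<ge> 1" and "n \<ge> 2"
    and "\<And>k. k \<le> n \<Longrightarrow> is_interval (Is k)"
    and "\<And>k. 1 \<le> k \<Longrightarrow> k \<le> n \<Longrightarrow> \<exists>a\<in>Is k. \<exists>b\<in>Is k. a < b"
    and "Is n = I"
    and "\<And>k. 1 \<le> k \<Longrightarrow> k \<le> n \<Longrightarrow> g k \<in> Is k \<rightarrow> Is (k - 1)"
    and "\<And>k. 1 \<le> k \<Longrightarrow> k \<le> n \<Longrightarrow> g k differentiable_on Is k"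
    and "\<And>k. k < n \<Longrightarrow> J k = comp_chain g (k + 1) n ` I" and "J n = I"
    and "\<And>k. 1 \<le> k \<Longrightarrow> k \<le> n \<Longrightarrow> deriv_within (Is k) (g k) \<in> Vp p (J k)"
    and "h \<in> Vp p I" and "t0 \<in> I"
    and "\<And>t. t \<in> I \<Longrightarrow> comp_chain g 1 n t = \<alpha> + (LBINT x=t0..t. h x)"
    and "f \<in> Vp p (J 0)"
  shows
    "comp_chain g 1 n differentiable_on I \<and>
     deriv_within I (comp_chain g 1 n) \<in> Vp p I \<and>
     Vp_norm p I (deriv_within I (comp_chain g 1 n)) =
       Vp_norm p I (\<lambda>t. deriv_within I (g n) t *
         (\<Prod>i = 1..n - 1. deriv_within (Is i) (g i) (comp_chain g (i + 1) n t))) \<and>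
     Vp_norm p I (\<lambda>t. deriv_within I (g n) t *
         (\<Prod>i = 1..n - 1. deriv_within (Is i) (g i) (comp_chain g (i + 1) n t)))
       \<le> 2 powr ((real n - 1) / p) * Vp_norm p I (deriv_within I (g n)) *
           (\<Prod>k = 1..n - 1. Vp_norm p (J k) (deriv_within (Is k) (g k))) \<and>
     (no_removable_discontinuity_on I h \<longrightarrow>
       (\<lambda>t. f (comp_chain g 1 n t) * h t) \<in> Vp p I \<and>
       Vp_norm p I (\<lambda>t. f (comp_chain g 1 n t) * h t)
         \<le> 2 powr (real n / p) * Vp_norm p (J 0) f * Vp_norm p I (deriv_within I (g n)) *
             (\<Prod>k = 1..n - 1. Vp_norm p (J k) (deriv_within (Is k) (g k))))"
proof -
  note p = assms(1) and n = assms(2) and J_last = assms(9) and dVp = assms(10)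
  define d where "d k = deriv_within (Is k) (g k)" for k
  define G where "G = comp_chain g 1 n"
  define D where "D t = (\<Prod>k = 1..n. d k (comp_chain g (Suc k) n t))" for t
  have deriv: "(g k has_real_derivative d k x) (at x within Is k)"
    if "1 \<le> k" "k \<le> n" "x \<in> Is k" for k x
    using assms(7)[OF that(1,2)] that(3)
    by (simp add: d_def differentiable_on_def vector_derivative_works has_real_derivative_iff_has_vector_derivative)
  have chain: "comp_chain g i n ` I \<subseteq> Is (i - 1)"
    "\<And>x. x \<in> I \<Longrightarrow> (comp_chain g i n has_real_derivative
      (\<Prod>k = i..n. d k (comp_chain g (Suc k) n x))) (at x within I)"
    if "1 \<le> i" "i \<le> Suc n" for i
    using comp_chain_has_derivative[where S = Is and d = d, OF assms(6) deriv that] assms(5) by auto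
  have J_eq: "J k = comp_chain g (Suc k) n ` I" if "k \<le> n" for k
    using that assms(8)[of k] J_last by (cases "k = n") auto
  have J_sub: "J k \<subseteq> Is k" if "k \<le> n" for k
    using chain(1)[of "Suc k"] J_eq that by simp
  have I_int: "is_interval I" using assms(3)[of n] assms(5) by simp
  have J_int: "is_interval (J k)" if "k \<le> n" for k
  proof -
    have "continuous_on I (comp_chain g (Suc k) n)"
      using chain(2)[of "Suc k"] that
      by (auto simp: continuous_on_eq_continuous_within intro: DERIV_continuous)
    then show ?thesis
      using I_int by (simp add: J_eq that is_interval_connected_1 connected_continuous_image)
  qed
  have J_ne: "J k \<noteq> {}" if "k \<le> n" for k using J_eq[OF that] assms(12) by auto
  have J_step: "J (k - 1) = g k ` J k" if "0 < k" "k \<le> n" for k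
    using that J_eq[of k] J_eq[of "k - 1"] by (simp add: comp_chain_first image_comp)
  have derivJ: "(g k has_real_derivative d k x) (at x within J k)"
    if "0 < k" "k \<le> n" "x \<in> J k" for k x
    using that J_sub by (intro DERIV_subset[OF deriv]) auto
  have dVp': "d k \<in> Vp p (J k)" if "0 < k" "k \<le> n" for k using dVp[of k] that by (simp add: d_def)
  have GD: "(G has_real_derivative D t) (at t within I)" if "t \<in> I" for t
    using chain(2)[of 1, OF _ _ that] by (simp add: G_def D_def)
  have diff: "G differentiable_on I"
    using GD by (meson differentiable_on_def has_field_derivative_imp_has_derivative differentiableI)
  have dG: "deriv_within I G t = D t" if "t \<in> I" for t
    using that GD[OF that] at_within_nondegenerate_interval[OF I_int _ that] assms(4)[of n] n assms(5)
    by (intro vector_derivative_within) (auto simp: has_real_derivative_iff_has_vector_derivative)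
  \<comment> \<open>The last factor of \<open>D\<close> is the derivative of \<open>g n\<close> itself, since the chain from \<open>n + 1\<close> is the identity.\<close>
  have D_eq: "(\<lambda>t. deriv_within I (g n) t *
         (\<Prod>i = 1..n - 1. deriv_within (Is i) (g i) (comp_chain g (i + 1) n t))) = D"
  proof -
    obtain m where m: "n = Suc m" using n by (cases n) auto
    show ?thesis using assms(5) by (auto simp: D_def d_def m mult.commute)
  qed
  have N_eq: "Vp_norm p I (deriv_within I (g n)) * (\<Prod>k = 1..n - 1. Vp_norm p (J k) (deriv_within (Is k) (g k)))
      = (\<Prod>k = 1..n. Vp_norm p (J k) (d k))"
  proof -
    obtain m where m: "n = Suc m" using n by (cases n) auto
    show ?thesis using assms(5) J_last by (auto simp: d_def m mult.commute)
  qed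
  have D1: "D = (\<lambda>t. d 1 (comp_chain g (Suc 1) n t) * (\<Prod>i = Suc 1..n. d i (comp_chain g (Suc i) n t)))"
    unfolding D_def using n by (subst prod.atLeast_Suc_atMost) auto
  have part1: "D \<in> Vp p I \<and> Vp_norm p I D \<le> 2 powr (real (n - 1) / p) * Vp_norm p (J 1) (d 1) *
      (\<Prod>k = Suc 1..n. Vp_norm p (J k) (d k))"
    unfolding D1 J_last[symmetric]
    using n by (intro Vp_norm_comp_chain_times_prod_le p J_int J_ne J_step derivJ dVp') auto
  have part2: "(\<lambda>t. f (G t) * D t) \<in> Vp p I \<and> Vp_norm p I (\<lambda>t. f (G t) * D t)
      \<le> 2 powr (real n / p) * Vp_norm p (J 0) f * (\<Prod>k = 1..n. Vp_norm p (J k) (d k))"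
    using Vp_norm_comp_chain_times_prod_le[where a = 0 and m = n and J = J and g = g and d = d and u = f,
        OF p _ J_int J_ne J_step derivJ dVp' assms(14)]
    by (simp add: G_def D_def J_last)
  have hD: "h t = D t" if "no_removable_discontinuity_on I h" "t \<in> I" for t
    using that Vp_integrand_tendsto_derivative[OF p I_int assms(11,12) _ that(2) GD[OF that(2)]]
      assms(13) unfolding no_removable_discontinuity_on_def G_def by blast
  have fh: "f (G t) * h t = f (G t) * D t" if "no_removable_discontinuity_on I h" "t \<in> I" for t
    using hD[OF that] by simp
  have P: "Vp_norm p (J 1) (d 1) * (\<Prod>k = Suc 1..n. Vp_norm p (J k) (d k)) = (\<Prod>k = 1..n. Vp_norm p (J k) (d k))"
    using n by (subst (2) prod.atLeast_Suc_atMost) auto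
  show ?thesis
    unfolding D_eq G_def[symmetric] mult.assoc N_eq
  proof (intro conjI impI)
    show "deriv_within I G \<in> Vp p I" using part1 Vp_cong[of I "deriv_within I G" D p, OF dG] by simp
    show "Vp_norm p I (deriv_within I G) = Vp_norm p I D" by (rule Vp_norm_cong) (rule dG)
    show "Vp_norm p I D \<le> 2 powr ((real n - 1) / p) * (\<Prod>k = 1..n. Vp_norm p (J k) (d k))"
      using part1 n unfolding mult.assoc P by (simp add: of_nat_diff)
    assume nr: "no_removable_discontinuity_on I h"
    show "(\<lambda>t. f (G t) * h t) \<in> Vp p I"
      using part2 Vp_cong[of I "\<lambda>t. f (G t) * h t" "\<lambda>t. f (G t) * D t" p, OF fh[OF nr]] by simp
    show "Vp_norm p I (\<lambda>t. f (G t) * h t)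
        \<le> 2 powr (real n / p) * (Vp_norm p (J 0) f * (\<Prod>k = 1..n. Vp_norm p (J k) (d k)))"
      using part2 Vp_norm_cong[of I "\<lambda>t. f (G t) * h t" "\<lambda>t. f (G t) * D t" p, OF fh[OF nr]] by (simp add: mult.assoc)
  qed (rule diff)
qed

end
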